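(* Let $n\in\mathbb{N}$, $n>1$, let $f\in\mathcal{A}$, and put $g=e^{f}\in\mathcal{M}$ and $h=e^{-f}\in\mathcal{I}_0$ (pointwise). Then the preorders on $\mathbb{Z}$ induced by $d^{(n)}_{(f,+)}$, $d^{(n)}_{(g,+)}$, $d^{(n)}_{(h,+)}$ and $d^{(n)}_{(h,\cdot)}$ are equivalent, i.e. for all $x,y\in\mathbb{Z}$, $$x\preceq_{d^{(n)}_{(f,+)}}y\iff x\preceq_{d^{(n)}_{(g,+)}}y\iff x\preceq_{d^{(n)}_{(h,+)}}y\iff x\preceq_{d^{(n)}_{(h,\cdot)}}y.$$ Furthermore, for every $h_0\in\mathcal{I}\setminus\mathcal{I}_0$ and all $x,y\in\mathbb{Z}$, $$x\preceq_{d^{(n)}_{(h_0,+)}}y\iff x\preceq_{d^{(n)}_{(h_0,\cdot)}}y.$$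
   Context: $\mathbb{N}$ is the set of positive integers. A function $f:\mathbb{N}\to\mathbb{R}$ is additive if $f(xy)=f(x)+f(y)$ for all coprime $x,y$; $g:\mathbb{N}\to\mathbb{R}$ is multiplicative if $g$ is not identically zero and $g(xy)=g(x)g(y)$ for all coprime $x,y$. With inequalities required for all $x\in\mathbb{N}$, $x>1$: $\mathcal{A}=\{f\text{ additive}: f(x)\ge0\}$, $\mathcal{M}=\{g\text{ multiplicative}: g(x)\ge1\}$, $\mathcal{I}=\{h\text{ multiplicative}: 0\le h(x)\le1\}$, $\mathcal{I}_0=\{h\in\mathcal{I}: 0<h(x)\le1\}$. The following pseudometrics on $\mathbb{Z}$ are $0$ when $x=y$, and for $x\ne y$ are given by $d^{(n)}_{(f,+)}(x,y)=f(\gcd(x,n))+f(\gcd(y,n))$ for $f\in\mathcal{A}$, $d^{(n)}_{(g,+)}(x,y)=g(\gcd(x,n))+g(\gcd(y,n))-2$ for $g\in\mathcal{M}$, $d^{(n)}_{(h,+)}(x,y)=2-h(\gcd(x,n))-h(\gcd(y,n))$ and $d^{(n)}_{(h,\cdot)}(x,y)=1-h(\gcd(x,n))\cdot h(\gcd(y,n))$ for $h\in\mathcal{I}$. The preorder induced by a pseudometric $d$ on $\mathbb{Z}$ is $x\preceq_d y\iff d(1,x)\le d(1,y)$. *)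

theory Defs
  imports Complex_Main
begin

text \<open>Arithmetic functions on the positive integers are represented as functions on
  \<^typ>\<open>nat\<close>; every condition below is restricted to positive arguments, so the value
  at \<open>0\<close> is irrelevant.\<close>

definition additive_fun :: "(nat \<Rightarrow> real) \<Rightarrow> bool" where
  "additive_fun f \<longleftrightarrow> (\<forall>x>0. \<forall>y>0. coprime x y \<longrightarrow> f (x * y) = f x + f y)"

definition multiplicative_fun :: "(nat \<Rightarrow> real) \<Rightarrow> bool" where
  "multiplicative_fun g \<longleftrightarrow>
     (\<exists>x>0. g x \<noteq> 0) \<and> (\<forall>x>0. \<forall>y>0. coprime x y \<longrightarrow> g (x * y) = g x * g y)"

definition class_A :: "(nat \<Rightarrow> real) set" where
  "class_A = {f. additive_fun f \<and> (\<forall>x>1. 0 \<le> f x)}"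

definition class_M :: "(nat \<Rightarrow> real) set" where
  "class_M = {g. multiplicative_fun g \<and> (\<forall>x>1. 1 \<le> g x)}"

definition class_I :: "(nat \<Rightarrow> real) set" where
  "class_I = {h. multiplicative_fun h \<and> (\<forall>x>1. 0 \<le> h x \<and> h x \<le> 1)}"

definition class_I0 :: "(nat \<Rightarrow> real) set" where
  "class_I0 = {h \<in> class_I. \<forall>x>1. 0 < h x \<and> h x \<le> 1}"

definition gcdn :: "nat \<Rightarrow> int \<Rightarrow> nat" where
  "gcdn n x = nat (gcd x (int n))"

definition dist_add :: "nat \<Rightarrow> (nat \<Rightarrow> real) \<Rightarrow> int \<Rightarrow> int \<Rightarrow> real" where
  "dist_add n f x y = (if x = y then 0 else f (gcdn n x) + f (gcdn n y))"

definition dist_mult_ge1 :: "nat \<Rightarrow> (nat \<Rightarrow> real) \<Rightarrow> int \<Rightarrow> int \<Rightarrow> real" where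
  "dist_mult_ge1 n g x y = (if x = y then 0 else g (gcdn n x) + g (gcdn n y) - 2)"

definition dist_mult_le1_sum :: "nat \<Rightarrow> (nat \<Rightarrow> real) \<Rightarrow> int \<Rightarrow> int \<Rightarrow> real" where
  "dist_mult_le1_sum n h x y = (if x = y then 0 else 2 - h (gcdn n x) - h (gcdn n y))"

definition dist_mult_le1_prod :: "nat \<Rightarrow> (nat \<Rightarrow> real) \<Rightarrow> int \<Rightarrow> int \<Rightarrow> real" where
  "dist_mult_le1_prod n h x y = (if x = y then 0 else 1 - h (gcdn n x) * h (gcdn n y))"

definition induced_le :: "(int \<Rightarrow> int \<Rightarrow> real) \<Rightarrow> int \<Rightarrow> int \<Rightarrow> bool" where
  "induced_le d x y \<longleftrightarrow> d 1 x \<le> d 1 y"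

end

theory Submission
  imports Defs
begin

text \<open>Since \<open>gcd(1,n) = 1\<close>, \<open>f 1 = 0\<close> and \<open>g 1 = h 1 = 1\<close>, the distance from \<open>1\<close> to \<open>x\<close>
  equals \<open>f d\<close>, \<open>g d - 1\<close>, \<open>1 - h d\<close> and \<open>1 - h d\<close> respectively, where \<open>d = gcd(x,n)\<close>; the
  case distinction at \<open>x = 1\<close> disappears because these expressions vanish at \<open>d = 1\<close>. The
  monotonicity of \<open>exp\<close> then identifies the preorders.\<close>

lemma gcdn_one [simp]: "gcdn n 1 = 1"
  by (simp add: gcdn_def)

lemma gcdn_pos: "n > 0 \<Longrightarrow> gcdn n x > 0"
  by (simp add: gcdn_def gcd_pos_int)

lemma additive_fun_one: "additive_fun f \<Longrightarrow> f 1 = 0"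
  unfolding additive_fun_def by (metis add_cancel_right_right coprime_1_right less_one mult_1)

lemma multiplicative_fun_one:
  assumes "multiplicative_fun g"
  shows "g 1 = 1"
proof -
  obtain x where x: "x > 0" "g x \<noteq> 0"
    using assms unfolding multiplicative_fun_def by blast
  \<comment> \<open>Cancelling the nonzero factor \<open>g x\<close> forces
    \<open>g 1 = 1\<close>.\<close>
  have "g (x * 1) = g x * g 1"
    using assms x(1) unfolding multiplicative_fun_def by (metis coprime_1_right zero_less_one)
  with x(2) show ?thesis by simp
qed

text \<open>The exponential turns sums into products. The factor \<open>c\<close> lets one lemma
  serve both \<open>exp (f k)\<close> (\<open>c = 1\<close>) and \<open>exp (- f k)\<close>
  (\<open>c = -1\<close>).\<close>

lemma multiplicative_fun_exp:
  assumes "additive_fun f" and "\<And>k. k > 0 \<Longrightarrow> g k = exp (c * f k)"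
  shows "multiplicative_fun g"
proof -
  \<comment> \<open>An exponential never vanishes, so 1 witnesses that \<open>g\<close> is not
    identically zero.\<close>
  have "g 1 \<noteq> 0"
    by (simp add: assms(2))
  then show ?thesis
    using assms unfolding multiplicative_fun_def additive_fun_def
    by (auto simp: distrib_left exp_add intro!: exI[of _ 1])
qed

lemma induced_le_dist_add:
  "additive_fun f \<Longrightarrow> induced_le (dist_add n f) x y \<longleftrightarrow> f (gcdn n x) \<le> f (gcdn n y)"
  using additive_fun_one[of f] by (auto simp: induced_le_def dist_add_def)

lemma induced_le_dist_mult_ge1:
  "multiplicative_fun g \<Longrightarrow>
    induced_le (dist_mult_ge1 n g) x y \<longleftrightarrow> g (gcdn n x) \<le> g (gcdn n y)"
  using multiplicative_fun_one[of g] by (auto simp: induced_le_def dist_mult_ge1_def)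

lemma induced_le_dist_mult_le1_sum:
  "multiplicative_fun h \<Longrightarrow>
    induced_le (dist_mult_le1_sum n h) x y \<longleftrightarrow> h (gcdn n y) \<le> h (gcdn n x)"
  using multiplicative_fun_one[of h] by (auto simp: induced_le_def dist_mult_le1_sum_def)

text \<open>As \<open>h 1 = 1\<close>, the product collapses to a single factor. The criterion is
  the one for the sum distance and allows zeros of \<open>h\<close>, which settles the claim about
  \<open>h0\<close>.\<close>

lemma induced_le_dist_mult_le1_prod:
  "multiplicative_fun h \<Longrightarrow>
    induced_le (dist_mult_le1_prod n h) x y \<longleftrightarrow> h (gcdn n y) \<le> h (gcdn n x)"
  using multiplicative_fun_one[of h] by (auto simp: induced_le_def dist_mult_le1_prod_def)

theorem theorem4p1:
  fixes n :: nat and f g h :: "nat \<Rightarrow> real"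
  assumes "n > 1"
    and "f \<in> class_A"
    and "\<And>k. k > 0 \<Longrightarrow> g k = exp (f k)"
    and "\<And>k. k > 0 \<Longrightarrow> h k = exp (- f k)"
  shows "g \<in> class_M \<and> h \<in> class_I0 \<and>
    (\<forall>x y :: int.
       (induced_le (dist_add n f) x y \<longleftrightarrow> induced_le (dist_mult_ge1 n g) x y) \<and>
       (induced_le (dist_mult_ge1 n g) x y \<longleftrightarrow> induced_le (dist_mult_le1_sum n h) x y) \<and>
       (induced_le (dist_mult_le1_sum n h) x y \<longleftrightarrow> induced_le (dist_mult_le1_prod n h) x y)) \<and>
    (\<forall>h0 \<in> class_I - class_I0. \<forall>x y :: int.
       induced_le (dist_mult_le1_sum n h0) x y \<longleftrightarrow> induced_le (dist_mult_le1_prod n h0) x y)"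
proof -
  have f: "additive_fun f" and f_nonneg: "\<And>k. k > 1 \<Longrightarrow> 0 \<le> f k"
    using assms(2) by (auto simp: class_A_def)
  have g: "multiplicative_fun g"
    using multiplicative_fun_exp[of f g 1] f assms(3) by simp
  have h: "multiplicative_fun h"
    using multiplicative_fun_exp[of f h "-1"] f assms(4) by simp
  have "g \<in> class_M"
    using g f_nonneg assms(3) by (auto simp: class_M_def)
  moreover have "h \<in> class_I0"
    using h f_nonneg assms(4) by (auto simp: class_I0_def class_I_def)
  \<comment> \<open>The formulas for \<open>g\<close> and \<open>h\<close> hold at positive
    arguments; this makes them available at every gcd, where \<open>exp\<close> preserves the order
    of the \<open>f\<close>-values and \<open>exp (- f k)\<close> reverses it.\<close>
  moreover have "gcdn n x > 0" for x
    using assms(1) by (simp add: gcdn_pos)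
  ultimately show ?thesis
    using f g h assms(3,4)
    by (auto simp: induced_le_dist_add induced_le_dist_mult_ge1 induced_le_dist_mult_le1_sum
        induced_le_dist_mult_le1_prod class_I_def)
qed

end
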